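(* Let $Q$ be an irreducible, aperiodic, homogeneous nearest-neighbour random walk on $\mathbb{Z}_+^2$ (as in the context) satisfying Conditions A, B.1, B.2, C and D, and suppose $\rho_1<1$ and $\rho_2<1$. Then the stationary distribution of $Q$ is given by $$x_{m,n}=\begin{cases} c_0\rho_1^m(\rho_1\rho_2)^n+c_1(\rho_1\rho_2)^{m+n}+d_1(\rho_1\rho_2)^m\rho_2^n, & m>0,\ n>0,\\ z_1(\rho_1\rho_2)^n+z_2\rho_2^n, & m=0,\ n\ge 0,\\ e_0\rho_1^m+e_1(\rho_1\rho_2)^m,& m\ge 0,\ n=0,\end{cases}$$ (the two expressions for $x_{0,0}$ coincide), where, writing $\gamma_0=\rho_1$, $\delta_0=\gamma_1=\rho_1\rho_2$, $\delta_1=\rho_2$, $$e_0=c_0\frac{Q_N(\gamma_0)}{H_N(\gamma_0)},\qquad c_1=-c_0\,\frac{\frac{V_E(\delta_0)}{\gamma_1}+L(\delta_0)}{\frac{V_E(\delta_0)}{\gamma_0}+L(\delta_0)},\qquad z_1=-c_0\,\frac{Q_E(\delta_0)\left(\frac1{\gamma_1}-\frac1{\gamma_0}\right)}{\frac{V_E(\delta_0)}{\gamma_0}+L(\delta_0)},$$ $$d_1=-c_1\,\frac{\frac{H_N(\gamma_1)}{\delta_1}+W(\gamma_1)}{\frac{H_N(\gamma_1)}{\delta_0}+W(\gamma_1)},\qquad e_1=-c_1\,\frac{Q_N(\gamma_1)\left(\frac1{\delta_1}-\frac1{\delta_0}\right)}{\frac{H_N(\gamma_1)}{\delta_0}+W(\gamma_1)},\qquad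 z_2=d_1\frac{Q_E(\delta_1)}{V_E(\delta_1)},$$ and the constant $c_0$ is determined by the normalization $\sum_{m,n\ge0}x_{m,n}=1$.
   Context: Random walk. $Q$ is a discrete-time Markov chain on $\mathbb{Z}_+^2=\{(m,n):m,n=0,1,2,\dots\}$. From $(m,n)$ it moves in one step to $(m+k,n+l)$, $k,l\in\{-1,0,1\}$, with probability: $q_{k,l}$ if $m,n\ge1$ (interior); $q^{(h)}_{k,l}$ if $m\ge1,n=0$ (horizontal boundary), where $q^{(h)}_{k,-1}=0$; $q^{(v)}_{k,l}$ if $m=0,n\ge1$ (vertical boundary), where $q^{(v)}_{-1,l}=0$; $q^{(0)}_{k,l}$ if $m=n=0$, where $q^{(0)}_{k,l}=0$ if $k=-1$ or $l=-1$. In each region the probabilities sum to 1. $Q$ is assumed irreducible and aperiodic. Condition A: $q_{1,1}=q_{-1,-1}=0$. Condition B.1: $q^{(h)}_{1,1}=q_{1,0}$, $q^{(h)}_{1,0}=q_{1,-1}$, $q^{(h)}_{-1,0}=q_{-1,0}$, $q^{(h)}_{-1,1}=q_{-1,1}$, and $q^{(v)}_{1,1}=q_{0,1}$, $q^{(v)}_{0,1}=q_{-1,1}$, $q^{(v)}_{0,-1}=q_{0,-1}$, $q^{(v)}_{1,-1}=q_{1,-1}$. Condition B.2: $q^{(0)}_{0,1}+q_{0,1}=q^{(h)}_{0,1}+q^{(v)}_{0,1}$, $q^{(0)}_{1,0}+q_{1,0}=q^{(h)}_{1,0}+q^{(v)}_{1,0}$, $q^{(0)}_{1,1}=q^{(h)}_{1,1}+q^{(v)}_{1,1}$.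 Condition C: $q_{1,0}q_{-1,0}=q_{0,1}q_{0,-1}=q_{-1,1}q_{1,-1}$. Condition D: $q^{(v)}_{1,0}=q_{1,0}+\frac{q_{1,-1}q_{0,1}}{q_{1,0}}$ and $q^{(h)}_{0,1}=q_{0,1}+\frac{q_{-1,1}q_{1,0}}{q_{0,1}}$ (in particular $q_{1,0},q_{0,1}\neq0$). Notation: $\rho_1=\frac{q_{1,0}+q_{1,-1}}{q_{-1,0}+q_{-1,1}}$, $\rho_2=\frac{q_{0,1}+q_{-1,1}}{q_{0,-1}+q_{1,-1}}$, and $Q_N(\gamma)=q_{-1,1}\gamma^2+q_{0,1}\gamma$, $H_N(\gamma)=q^{(h)}_{-1,1}\gamma^2+q^{(h)}_{0,1}\gamma+q^{(h)}_{1,1}$, $W(\gamma)=q^{(h)}_{-1,0}\gamma^2-(1-q^{(h)}_{0,0})\gamma+q^{(h)}_{1,0}$, $Q_E(\delta)=q_{1,-1}\delta^2+q_{1,0}\delta$, $V_E(\delta)=q^{(v)}_{1,-1}\delta^2+q^{(v)}_{1,0}\delta+q^{(v)}_{1,1}$, $L(\delta)=q^{(v)}_{0,-1}\delta^2-(1-q^{(v)}_{0,0})\delta+q^{(v)}_{0,1}$. *)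

theory Defs
  imports "HOL-Probability.Probability"
begin

text \<open>
  Step laws of a homogeneous nearest-neighbour walk on the quarter plane: the increment
  \<open>(k, l)\<close> is drawn from \<open>int_step\<close> if \<open>m, n \<ge> 1\<close>, from \<open>hor_step\<close> if \<open>m \<ge> 1, n = 0\<close>,
  from \<open>ver_step\<close> if \<open>m = 0, n \<ge> 1\<close> and from \<open>org_step\<close> if \<open>m = n = 0\<close>.
\<close>

record walk =
  int_step :: "(int \<times> int) pmf"
  hor_step :: "(int \<times> int) pmf"
  ver_step :: "(int \<times> int) pmf"
  org_step :: "(int \<times> int) pmf"

abbreviation q :: "walk \<Rightarrow> int \<Rightarrow> int \<Rightarrow> real" where
  "q Q k l \<equiv> pmf (int_step Q) (k, l)"

abbreviation qh :: "walk \<Rightarrow> int \<Rightarrow> int \<Rightarrow> real" where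
  "qh Q k l \<equiv> pmf (hor_step Q) (k, l)"

abbreviation qv :: "walk \<Rightarrow> int \<Rightarrow> int \<Rightarrow> real" where
  "qv Q k l \<equiv> pmf (ver_step Q) (k, l)"

abbreviation qo :: "walk \<Rightarrow> int \<Rightarrow> int \<Rightarrow> real" where
  "qo Q k l \<equiv> pmf (org_step Q) (k, l)"

definition nearest_neighbour :: "walk \<Rightarrow> bool" where
  "nearest_neighbour Q \<longleftrightarrow>
     set_pmf (int_step Q) \<subseteq> {-1, 0, 1} \<times> {-1, 0, 1} \<and>
     set_pmf (hor_step Q) \<subseteq> {-1, 0, 1} \<times> {0, 1} \<and>
     set_pmf (ver_step Q) \<subseteq> {0, 1} \<times> {-1, 0, 1} \<and>
     set_pmf (org_step Q) \<subseteq> {0, 1} \<times> {0, 1}"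

definition step_law :: "walk \<Rightarrow> nat \<times> nat \<Rightarrow> (int \<times> int) pmf" where
  "step_law Q = (\<lambda>(m, n).
     if m \<ge> 1 \<and> n \<ge> 1 then int_step Q
     else if m \<ge> 1 then hor_step Q
     else if n \<ge> 1 then ver_step Q
     else org_step Q)"

text \<open>The conversion \<open>nat\<close> never truncates here when \<open>nearest_neighbour Q\<close> holds.\<close>

definition walk_kernel :: "walk \<Rightarrow> nat \<times> nat \<Rightarrow> (nat \<times> nat) pmf" where
  "walk_kernel Q = (\<lambda>(m, n).
     map_pmf (\<lambda>(k, l). (nat (int m + k), nat (int n + l))) (step_law Q (m, n)))"

primrec kernel_pow :: "('s \<Rightarrow> 's pmf) \<Rightarrow> nat \<Rightarrow> 's \<Rightarrow> 's pmf" where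
  "kernel_pow K 0 s = return_pmf s"
| "kernel_pow K (Suc n) s = bind_pmf (K s) (kernel_pow K n)"

definition irreducible_chain :: "('s \<Rightarrow> 's pmf) \<Rightarrow> bool" where
  "irreducible_chain K \<longleftrightarrow> (\<forall>s t. \<exists>n. pmf (kernel_pow K n s) t > 0)"

definition aperiodic_chain :: "('s \<Rightarrow> 's pmf) \<Rightarrow> bool" where
  "aperiodic_chain K \<longleftrightarrow> (\<forall>s. Gcd {n. n > 0 \<and> pmf (kernel_pow K n s) s > 0} = 1)"

definition stationary_distribution :: "('s \<Rightarrow> 's pmf) \<Rightarrow> 's pmf \<Rightarrow> bool" where
  "stationary_distribution K \<pi> \<longleftrightarrow> bind_pmf \<pi> K = \<pi>"

definition cond_A :: "walk \<Rightarrow> bool" where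
  "cond_A Q \<longleftrightarrow> q Q 1 1 = 0 \<and> q Q (-1) (-1) = 0"

definition cond_B1 :: "walk \<Rightarrow> bool" where
  "cond_B1 Q \<longleftrightarrow>
     qh Q 1 1 = q Q 1 0 \<and> qh Q 1 0 = q Q 1 (-1) \<and>
     qh Q (-1) 0 = q Q (-1) 0 \<and> qh Q (-1) 1 = q Q (-1) 1 \<and>
     qv Q 1 1 = q Q 0 1 \<and> qv Q 0 1 = q Q (-1) 1 \<and>
     qv Q 0 (-1) = q Q 0 (-1) \<and> qv Q 1 (-1) = q Q 1 (-1)"

definition cond_B2 :: "walk \<Rightarrow> bool" where
  "cond_B2 Q \<longleftrightarrow>
     qo Q 0 1 + q Q 0 1 = qh Q 0 1 + qv Q 0 1 \<and>
     qo Q 1 0 + q Q 1 0 = qh Q 1 0 + qv Q 1 0 \<and>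
     qo Q 1 1 = qh Q 1 1 + qv Q 1 1"

definition cond_C :: "walk \<Rightarrow> bool" where
  "cond_C Q \<longleftrightarrow>
     q Q 1 0 * q Q (-1) 0 = q Q 0 1 * q Q 0 (-1) \<and>
     q Q 0 1 * q Q 0 (-1) = q Q (-1) 1 * q Q 1 (-1)"

definition cond_D :: "walk \<Rightarrow> bool" where
  "cond_D Q \<longleftrightarrow>
     q Q 1 0 \<noteq> 0 \<and> q Q 0 1 \<noteq> 0 \<and>
     qv Q 1 0 = q Q 1 0 + q Q 1 (-1) * q Q 0 1 / q Q 1 0 \<and>
     qh Q 0 1 = q Q 0 1 + q Q (-1) 1 * q Q 1 0 / q Q 0 1"

text \<open>
  All denominators in the expressions below are nonzero for an irreducible nearest-neighbour
  walk that satisfies the conditions above and \<open>\<rho>1 Q < 1\<close>, \<open>\<rho>2 Q < 1\<close>.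
\<close>

definition \<rho>1 :: "walk \<Rightarrow> real" where
  "\<rho>1 Q = (q Q 1 0 + q Q 1 (-1)) / (q Q (-1) 0 + q Q (-1) 1)"

definition \<rho>2 :: "walk \<Rightarrow> real" where
  "\<rho>2 Q = (q Q 0 1 + q Q (-1) 1) / (q Q 0 (-1) + q Q 1 (-1))"

definition Q_N :: "walk \<Rightarrow> real \<Rightarrow> real" where
  "Q_N Q \<gamma> = q Q (-1) 1 * \<gamma>\<^sup>2 + q Q 0 1 * \<gamma>"

definition H_N :: "walk \<Rightarrow> real \<Rightarrow> real" where
  "H_N Q \<gamma> = qh Q (-1) 1 * \<gamma>\<^sup>2 + qh Q 0 1 * \<gamma> + qh Q 1 1"

definition W_poly :: "walk \<Rightarrow> real \<Rightarrow> real" where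
  "W_poly Q \<gamma> = qh Q (-1) 0 * \<gamma>\<^sup>2 - (1 - qh Q 0 0) * \<gamma> + qh Q 1 0"

definition Q_E :: "walk \<Rightarrow> real \<Rightarrow> real" where
  "Q_E Q \<delta> = q Q 1 (-1) * \<delta>\<^sup>2 + q Q 1 0 * \<delta>"

definition V_E :: "walk \<Rightarrow> real \<Rightarrow> real" where
  "V_E Q \<delta> = qv Q 1 (-1) * \<delta>\<^sup>2 + qv Q 1 0 * \<delta> + qv Q 1 1"

definition L_poly :: "walk \<Rightarrow> real \<Rightarrow> real" where
  "L_poly Q \<delta> = qv Q 0 (-1) * \<delta>\<^sup>2 - (1 - qv Q 0 0) * \<delta> + qv Q 0 1"

definition \<gamma>0 :: "walk \<Rightarrow> real" where "\<gamma>0 Q = \<rho>1 Q"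
definition \<gamma>1 :: "walk \<Rightarrow> real" where "\<gamma>1 Q = \<rho>1 Q * \<rho>2 Q"
definition \<delta>0 :: "walk \<Rightarrow> real" where "\<delta>0 Q = \<rho>1 Q * \<rho>2 Q"
definition \<delta>1 :: "walk \<Rightarrow> real" where "\<delta>1 Q = \<rho>2 Q"

definition coef_e0 :: "walk \<Rightarrow> real \<Rightarrow> real" where
  "coef_e0 Q c0 = c0 * (Q_N Q (\<gamma>0 Q) / H_N Q (\<gamma>0 Q))"

definition coef_c1 :: "walk \<Rightarrow> real \<Rightarrow> real" where
  "coef_c1 Q c0 = - c0 *
     ((V_E Q (\<delta>0 Q) / \<gamma>1 Q + L_poly Q (\<delta>0 Q)) / (V_E Q (\<delta>0 Q) / \<gamma>0 Q + L_poly Q (\<delta>0 Q)))"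

definition coef_z1 :: "walk \<Rightarrow> real \<Rightarrow> real" where
  "coef_z1 Q c0 = - c0 *
     (Q_E Q (\<delta>0 Q) * (1 / \<gamma>1 Q - 1 / \<gamma>0 Q) / (V_E Q (\<delta>0 Q) / \<gamma>0 Q + L_poly Q (\<delta>0 Q)))"

definition coef_d1 :: "walk \<Rightarrow> real \<Rightarrow> real" where
  "coef_d1 Q c0 = - coef_c1 Q c0 *
     ((H_N Q (\<gamma>1 Q) / \<delta>1 Q + W_poly Q (\<gamma>1 Q)) / (H_N Q (\<gamma>1 Q) / \<delta>0 Q + W_poly Q (\<gamma>1 Q)))"

definition coef_e1 :: "walk \<Rightarrow> real \<Rightarrow> real" where
  "coef_e1 Q c0 = - coef_c1 Q c0 *
     (Q_N Q (\<gamma>1 Q) * (1 / \<delta>1 Q - 1 / \<delta>0 Q) / (H_N Q (\<gamma>1 Q) / \<delta>0 Q + W_poly Q (\<gamma>1 Q)))"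

definition coef_z2 :: "walk \<Rightarrow> real \<Rightarrow> real" where
  "coef_z2 Q c0 = coef_d1 Q c0 * (Q_E Q (\<delta>1 Q) / V_E Q (\<delta>1 Q))"

text \<open>At the origin the expression for \<open>m = 0\<close> is taken; the one for \<open>n = 0\<close> has the same value there.\<close>

definition x_form :: "walk \<Rightarrow> real \<Rightarrow> nat \<Rightarrow> nat \<Rightarrow> real" where
  "x_form Q c0 m n =
     (if m > 0 \<and> n > 0 then
        c0 * \<rho>1 Q ^ m * (\<rho>1 Q * \<rho>2 Q) ^ n
        + coef_c1 Q c0 * (\<rho>1 Q * \<rho>2 Q) ^ (m + n)
        + coef_d1 Q c0 * (\<rho>1 Q * \<rho>2 Q) ^ m * \<rho>2 Q ^ n
      else if m = 0 then
        coef_z1 Q c0 * (\<rho>1 Q * \<rho>2 Q) ^ n + coef_z2 Q c0 * \<rho>2 Q ^ n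
      else
        coef_e0 Q c0 * \<rho>1 Q ^ m + coef_e1 Q c0 * (\<rho>1 Q * \<rho>2 Q) ^ m)"

end

theory Submission
  imports Defs
begin

text \<open>
  A product \<open>\<gamma> ^ m * \<delta> ^ n\<close> solves the interior balance equations exactly when \<open>(\<gamma>, \<delta>)\<close> is on a
  curve that is quadratic in each variable. So for each \<open>\<delta>\<close> there are two values of \<open>\<gamma>\<close>, and for each
  \<open>\<gamma>\<close> two values of \<open>\<delta>\<close>. The three terms of the formula are consecutive points of this curve:
  \<open>(\<rho>1, \<rho>1 \<rho>2)\<close> and \<open>(\<rho>1 \<rho>2, \<rho>1 \<rho>2)\<close> share \<open>\<delta>\<close>, while \<open>(\<rho>1 \<rho>2, \<rho>1 \<rho>2)\<close> and \<open>(\<rho>1 \<rho>2, \<rho>2)\<close> share \<open>\<gamma>\<close>.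
  The first one meets the equations of the horizontal axis, together with \<open>e\<^sub>0 * \<rho>1 ^ m\<close> there. Its
  error on the vertical axis has the form \<open>(\<rho>1 \<rho>2) ^ n\<close> and is compensated by the second one. The
  error of the second one on the horizontal axis is compensated by the third one, which meets the
  equations of the vertical axis. Condition C is why the curve passes through these points;
  Condition D is why the first and the last one each fit an axis without a partner.

  Irreducibility and Condition C make all six interior rates positive. They are then determined by
  four numbers \<open>p = \<rho>1\<close>, \<open>s = \<rho>2\<close>, \<open>e = q Q (-1) 1\<close> and \<open>f = q Q 1 (-1)\<close>, namely
  \<open>q Q 1 0 = p * e\<close>, \<open>q Q (-1) 0 = f / p\<close>, \<open>q Q 0 1 = s * f\<close> and \<open>q Q 0 (-1) = e / s\<close>
  (\<open>geometric_walkI\<close>). In these numbers the coefficients of the formula are, up to a common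
  factor, polynomials (\<open>coefs\<close>), and reflection in the diagonal \<open>m = n\<close> is the exchange of \<open>(p, e)\<close>
  and \<open>(s, f)\<close>, so that the balance equations of one axis give those of the other.

  The equations that the three terms satisfy in the interior and on the axes imply invariance also
  next to the axes and, with three more equations, around the origin (\<open>compensation_balance\<close>). The
  formula is positive for \<open>c\<^sub>0 > 0\<close>, although then \<open>c\<^sub>1 < 0\<close> (\<open>bulk_pos\<close>, \<open>edge_pos\<close>), and
  summable because \<open>\<rho>1 < 1\<close> and \<open>\<rho>2 < 1\<close>, so one choice of \<open>c\<^sub>0\<close> makes it a stationary
  distribution. An irreducible chain has at most one (\<open>stationary_distribution_unique\<close>).
\<close>

section \<open>Stationary distributions of irreducible chains\<close>

lemma stationary_distribution_iff_finite_sums: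
  assumes fin: "\<And>t. finite (P t)"
    and pred: "\<And>s t. pmf (K s) t \<noteq> 0 \<Longrightarrow> s \<in> P t"
  shows "stationary_distribution K \<pi> \<longleftrightarrow> (\<forall>t. (\<Sum>s\<in>P t. pmf \<pi> s * pmf (K s) t) = pmf \<pi> t)"
proof -
  have "pmf (bind_pmf \<pi> K) t = (\<Sum>s\<in>P t. pmf \<pi> s * pmf (K s) t)" for t
    unfolding pmf_bind using integral_measure_pmf[OF fin[of t], of \<pi> "\<lambda>s. pmf (K s) t"] pred by simp
  then show ?thesis
    unfolding stationary_distribution_def by (simp add: pmf_eq_iff)
qed

lemma bind_kernel_pow_stationary:
  assumes "stationary_distribution K \<pi>"
  shows "bind_pmf \<pi> (kernel_pow K n) = \<pi>"
proof (induction n)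
  case 0
  show ?case by (simp add: bind_return_pmf')
next
  case (Suc n)
  have "bind_pmf \<pi> (kernel_pow K (Suc n)) = bind_pmf (bind_pmf \<pi> K) (kernel_pow K n)"
    unfolding bind_assoc_pmf by (intro bind_pmf_cong refl) simp
  also have "\<dots> = \<pi>"
    using assms Suc by (simp only: stationary_distribution_def)
  finally show ?case .
qed

text \<open>
  The difference of the two expectations is the sum of the products in the conclusion, so equal
  expectations leave a vanishing sum of nonnegative terms.
\<close>

lemma nonneg_pmf_diff_eq_0:
  fixes h :: "'s \<Rightarrow> real"
  assumes bound: "\<And>s. \<bar>h s\<bar> \<le> C"
    and nonneg: "\<And>s. h s * (pmf \<mu> s - pmf \<nu> s) \<ge> 0"
    and eq: "measure_pmf.expectation \<mu> h = measure_pmf.expectation \<nu> h"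
  shows "h s * (pmf \<mu> s - pmf \<nu> s) = 0"
proof -
  have int: "integrable (count_space UNIV) (\<lambda>s. pmf \<rho> s * h s)" for \<rho> :: "'s pmf"
  proof -
    have "integrable (measure_pmf \<rho>) h"
      using bound by (intro measure_pmf.integrable_const_bound[where B = C]) auto
    then show ?thesis by (simp add: measure_pmf_eq_density integrable_density)
  qed
  have E: "measure_pmf.expectation \<rho> h = (\<integral>s. pmf \<rho> s * h s \<partial>count_space UNIV)" for \<rho> :: "'s pmf"
    by (simp add: measure_pmf_eq_density integral_density)
  have h: "(\<lambda>s. h s * (pmf \<mu> s - pmf \<nu> s)) = (\<lambda>s. pmf \<mu> s * h s - pmf \<nu> s * h s)"
    by (simp add: algebra_simps)
  have "integrable (count_space UNIV) (\<lambda>s. h s * (pmf \<mu> s - pmf \<nu> s))"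
    unfolding h by (intro Bochner_Integration.integrable_diff int)
  moreover have "(\<integral>s. h s * (pmf \<mu> s - pmf \<nu> s) \<partial>count_space UNIV) = 0"
    unfolding h using eq by (simp add: Bochner_Integration.integral_diff int E)
  ultimately have "AE s in count_space UNIV. h s * (pmf \<mu> s - pmf \<nu> s) = 0"
    using nonneg by (simp add: integral_nonneg_eq_0_iff_AE)
  then show ?thesis by (simp add: AE_count_space)
qed

lemma prob_bind_pmf:
  "measure_pmf.prob (bind_pmf \<mu> K) A = measure_pmf.expectation \<mu> (\<lambda>s. measure_pmf.prob (K s) A)"
proof -
  have "integrable (measure_pmf \<mu>) (\<lambda>s. measure_pmf.prob (K s) A)"
    by (intro measure_pmf.integrable_const_bound[where B = 1]) auto
  then have "emeasure (bind_pmf \<mu> K) A = ennreal (measure_pmf.expectation \<mu> (\<lambda>s. measure_pmf.prob (K s) A))"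
    unfolding emeasure_bind_pmf unfolding measure_pmf.emeasure_eq_measure
    by (intro nn_integral_eq_integral) auto
  moreover have "0 \<le> measure_pmf.expectation \<mu> (\<lambda>s. measure_pmf.prob (K s) A)"
    by (simp add: integral_nonneg_AE)
  ultimately show ?thesis
    using enn2real_ennreal measure_def[of "measure_pmf (bind_pmf \<mu> K)" A] by metis
qed

text \<open>
  Let \<open>A\<close> be the set where \<open>\<mu>\<close> exceeds \<open>\<nu>\<close> and \<open>g s\<close> the probability of being in \<open>A\<close> after \<open>n\<close> steps
  from \<open>s\<close>. As \<open>0 \<le> g \<le> 1\<close>, the function \<open>1\<^sub>A - g\<close> has the sign of \<open>\<mu> - \<nu>\<close>, and its expectation
  vanishes under both measures by stationarity. So \<open>g = 0\<close> wherever \<open>\<mu> < \<nu>\<close>: such states do not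
  reach \<open>A\<close>, and by irreducibility \<open>A\<close> is empty or there are no such states. Both measures have
  total mass 1, so each alternative gives equality.
\<close>

lemma stationary_distribution_unique:
  fixes K :: "'s \<Rightarrow> 's pmf"
  assumes irr: "irreducible_chain K"
    and st: "stationary_distribution K \<mu>" "stationary_distribution K \<nu>"
  shows "\<mu> = \<nu>"
proof -
  define A where "A = {s. pmf \<mu> s > pmf \<nu> s}"
  \<comment> \<open>Every summand of the vanishing sum of \<open>(1\<^sub>A - g) * (\<mu> - \<nu>)\<close> is zero.\<close>
  have zero: "(indicator A s - measure_pmf.prob (kernel_pow K n s) A) * (pmf \<mu> s - pmf \<nu> s) = 0" for n s
  proof (rule nonneg_pmf_diff_eq_0[where C = 1])
    show "\<bar>indicator A s - measure_pmf.prob (kernel_pow K n s) A\<bar> \<le> 1" for s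
    proof -
      have "\<bar>indicator A s - x\<bar> \<le> 1" if "0 \<le> x" "x \<le> 1" for x :: real
        using that by (auto simp: indicator_def)
      then show ?thesis by simp
    qed
    show "(indicator A s - measure_pmf.prob (kernel_pow K n s) A) * (pmf \<mu> s - pmf \<nu> s) \<ge> 0" for s
      by (cases "s \<in> A") (auto simp: A_def mult_nonneg_nonpos)
    have "measure_pmf.expectation \<rho> (\<lambda>s. indicator A s - measure_pmf.prob (kernel_pow K n s) A) = 0"
      if "stationary_distribution K \<rho>" for \<rho>
    proof -
      have "measure_pmf.expectation \<rho> (\<lambda>s. indicator A s - measure_pmf.prob (kernel_pow K n s) A)
          = measure_pmf.prob \<rho> A - measure_pmf.expectation \<rho> (\<lambda>s. measure_pmf.prob (kernel_pow K n s) A)"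
        by (subst Bochner_Integration.integral_diff)
          (auto intro!: measure_pmf.integrable_const_bound[where B = 1])
      also have "\<dots> = 0"
        using bind_kernel_pow_stationary[OF that, of n] prob_bind_pmf[of \<rho> "kernel_pow K n" A] by simp
      finally show ?thesis .
    qed
    with st show "measure_pmf.expectation \<mu> (\<lambda>s. indicator A s - measure_pmf.prob (kernel_pow K n s) A)
        = measure_pmf.expectation \<nu> (\<lambda>s. indicator A s - measure_pmf.prob (kernel_pow K n s) A)"
      by simp
  qed
  have "A = {}"
  proof (rule ccontr)
    assume "A \<noteq> {}"
    then obtain t where t: "t \<in> A" by blast
    have "pmf \<mu> s \<ge> pmf \<nu> s" for s
    proof (rule ccontr)
      assume less: "\<not> pmf \<mu> s \<ge> pmf \<nu> s"
      obtain n where n: "pmf (kernel_pow K n s) t > 0"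
        using irr by (auto simp: irreducible_chain_def)
      have "measure_pmf.prob (kernel_pow K n s) A = 0"
        using zero[of s n] less by (simp add: A_def)
      then show False
        using n t measure_pmf.finite_measure_mono[of "{t}" A "kernel_pow K n s"]
        by (simp add: measure_pmf_single)
    qed
    then have "1 * (pmf \<mu> t - pmf \<nu> t) = 0"
      by (intro nonneg_pmf_diff_eq_0[where C = 1]) auto
    with t show False by (simp add: A_def)
  qed
  then have "pmf \<mu> s \<le> pmf \<nu> s" for s unfolding A_def by (meson Collect_empty_eq linorder_not_less)
  then have "- 1 * (pmf \<mu> s - pmf \<nu> s) = 0" for s
    by (intro nonneg_pmf_diff_eq_0[where C = 1]) auto
  then show ?thesis by (simp add: pmf_eq_iff)
qed

text \<open>The form in which irreducibility is used to show that some steps have positive probability.\<close>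

lemma irreducible_chain_closed_set:
  assumes "irreducible_chain K" "s \<in> C" "\<And>s. s \<in> C \<Longrightarrow> set_pmf (K s) \<subseteq> C"
  shows "t \<in> C"
proof -
  have "set_pmf (kernel_pow K n s) \<subseteq> C" if "s \<in> C" for n s
    using that
  proof (induction n arbitrary: s)
    case (Suc n)
    then show ?case using assms(3)[of s] by auto
  qed auto
  moreover obtain n where "pmf (kernel_pow K n s) t > 0"
    using assms(1) by (auto simp: irreducible_chain_def)
  ultimately show ?thesis using assms(2) by (metis less_irrefl set_pmf_iff subsetD)
qed

section \<open>One-step transition probabilities of the walk\<close>

lemma set_step_law:
  assumes "nearest_neighbour Q"
  shows "set_pmf (step_law Q (i, j)) \<subseteq>
    (if i \<ge> 1 then {-1, 0, 1} else {0, 1}) \<times> (if j \<ge> 1 then {-1, 0, 1} else {0, 1})"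
  using assms by (simp add: step_law_def nearest_neighbour_def)

lemma set_step_law_subset:
  assumes "nearest_neighbour Q"
  shows "set_pmf (step_law Q (i, j)) \<subseteq> {-1, 0, 1} \<times> {-1, 0, 1}"
proof -
  have "(if k \<ge> 1 then {-1, 0, 1} else {0, 1}) \<subseteq> {-1, 0, 1 :: int}" for k :: nat by simp
  then show ?thesis using set_step_law[OF assms, of i j] Sigma_mono by (meson order_trans)
qed

text \<open>
  No step leaves the quadrant, so the truncation by \<open>nat\<close> is injective on the possible steps and
  distinct steps lead to distinct states.
\<close>

lemma pmf_walk_kernel:
  assumes nn: "nearest_neighbour Q"
  shows "pmf (walk_kernel Q (i, j)) (m, n) = pmf (step_law Q (i, j)) (int m - int i, int n - int j)"
proof -
  define f where "f = (\<lambda>(k, l). (nat (int i + k), nat (int j + l)))"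
  define p where "p = step_law Q (i, j)"
  have range: "int i + k \<ge> 0 \<and> int j + l \<ge> 0" if "(k, l) \<in> set_pmf p" for k l
    using that set_step_law[OF nn, of i j] by (auto simp: p_def split: if_splits)
  have inj: "inj_on f (set_pmf p)"
    by (auto simp: inj_on_def f_def dest!: range)
  have K: "walk_kernel Q (i, j) = map_pmf f p"
    by (simp add: walk_kernel_def f_def p_def)
  define z where "z = (int m - int i, int n - int j)"
  have fz: "f z = (m, n)" by (simp add: f_def z_def)
  show ?thesis
  proof (cases "z \<in> set_pmf p")
    case True
    then show ?thesis using pmf_map_inj[OF inj True] fz K by (simp add: z_def p_def)
  next
    case False
    have "(m, n) \<notin> f ` set_pmf p"
    proof
      assume "(m, n) \<in> f ` set_pmf p"
      then obtain k l where kl: "(k, l) \<in> set_pmf p" "m = nat (int i + k)" "n = nat (int j + l)"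
        by (auto simp: f_def)
      then have "z = (k, l)" using range[of k l] by (simp add: z_def)
      with kl False show False by simp
    qed
    then have "pmf (walk_kernel Q (i, j)) (m, n) = 0"
      unfolding K by (intro pmf_map_outside)
    moreover have "pmf p z = 0" using False by (simp add: set_pmf_iff)
    ultimately show ?thesis by (simp add: z_def p_def)
  qed
qed

text \<open>A finite set that contains all predecessors of a state turns stationarity into finite sums.\<close>

lemma pmf_walk_kernel_nonzeroD:
  assumes nn: "nearest_neighbour Q" and "pmf (walk_kernel Q s) (m, n) \<noteq> 0"
  shows "s \<in> {m - 1..m + 1} \<times> {n - 1..n + 1}"
proof -
  obtain i j where s: "s = (i, j)" by fastforce
  have "(int m - int i, int n - int j) \<in> set_pmf (step_law Q (i, j))"
    using assms pmf_walk_kernel[OF nn, of i j m n] by (simp add: s set_pmf_iff)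
  also have "\<dots> \<subseteq> {-1, 0, 1} \<times> {-1, 0, 1}"
    by (rule set_step_law_subset[OF nn])
  finally have "int m - int i \<in> {-1, 0, 1}" "int n - int j \<in> {-1, 0, 1}"
    by (simp_all only: mem_Sigma_iff)
  then have "\<bar>int m - int i\<bar> \<le> 1" "\<bar>int n - int j\<bar> \<le> 1" by auto
  then have "m - 1 \<le> i" "i \<le> m + 1" "n - 1 \<le> j" "j \<le> n + 1" by linarith+
  then show ?thesis by (simp add: s)
qed

text \<open>Otherwise the half-plane \<open>m \<ge> 1\<close> is closed and the origin cannot be reached from it.\<close>

lemma irreducible_walk_steps_left:
  assumes nn: "nearest_neighbour Q" and irr: "irreducible_chain (walk_kernel Q)"
  shows "\<exists>l. q Q (-1) l > 0 \<or> qh Q (-1) l > 0"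
proof (rule ccontr)
  assume "\<not> ?thesis"
  then have none: "(-1, l) \<notin> set_pmf (int_step Q)" "(-1, l) \<notin> set_pmf (hor_step Q)" for l
    by (auto simp: set_pmf_iff pmf_nonneg order_less_le)
  have "(0, 0) \<in> {(m :: nat, n :: nat). m \<ge> 1}"
  proof (rule irreducible_chain_closed_set[OF irr, of "(1, 0)"])
    fix r assume "r \<in> {(m :: nat, n :: nat). m \<ge> 1}"
    then obtain i j where r: "r = (i, j)" "i \<ge> 1" by auto
    show "set_pmf (walk_kernel Q r) \<subseteq> {(m, n). m \<ge> 1}"
    proof clarify
      fix m n assume "(m, n) \<in> set_pmf (walk_kernel Q r)"
      then have mem: "(int m - int i, int n - int j) \<in> set_pmf (step_law Q (i, j))"
        by (simp add: r(1) set_pmf_iff pmf_walk_kernel[OF nn])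
      then have "int m - int i \<in> {-1, 0, 1}"
        using set_step_law_subset[OF nn, of i j] by blast
      moreover have "int m - int i \<noteq> -1"
        using mem r(2) none by (auto simp: step_law_def split: if_splits)
      ultimately show "m \<ge> 1" using r(2) by auto
    qed
  qed simp
  then show False by simp
qed

lemma irreducible_walk_steps_down:
  assumes nn: "nearest_neighbour Q" and irr: "irreducible_chain (walk_kernel Q)"
  shows "\<exists>k. q Q k (-1) > 0 \<or> qv Q k (-1) > 0"
proof (rule ccontr)
  assume "\<not> ?thesis"
  then have none: "(k, -1) \<notin> set_pmf (int_step Q)" "(k, -1) \<notin> set_pmf (ver_step Q)" for k
    by (auto simp: set_pmf_iff pmf_nonneg order_less_le)
  have "(0, 0) \<in> {(m :: nat, n :: nat). n \<ge> 1}"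
  proof (rule irreducible_chain_closed_set[OF irr, of "(0, 1)"])
    fix r assume "r \<in> {(m :: nat, n :: nat). n \<ge> 1}"
    then obtain i j where r: "r = (i, j)" "j \<ge> 1" by auto
    show "set_pmf (walk_kernel Q r) \<subseteq> {(m, n). n \<ge> 1}"
    proof clarify
      fix m n assume "(m, n) \<in> set_pmf (walk_kernel Q r)"
      then have mem: "(int m - int i, int n - int j) \<in> set_pmf (step_law Q (i, j))"
        by (simp add: r(1) set_pmf_iff pmf_walk_kernel[OF nn])
      then have "int n - int j \<in> {-1, 0, 1}"
        using set_step_law_subset[OF nn, of i j] by blast
      moreover have "int n - int j \<noteq> -1"
        using mem r(2) none by (auto simp: step_law_def split: if_splits)
      ultimately show "n \<ge> 1" using r(2) by auto
    qed
  qed simp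
  then show False by simp
qed

section \<open>Compensation on the two axes\<close>

text \<open>
  Here \<open>y\<close> is the interior formula, continued to the axes by the same expression, while \<open>v\<close> and \<open>h\<close>
  are the actual values on the axes. The flux equations say that an axis feeds the adjacent interior
  states as much as the continued \<open>y\<close> would with interior rates, so the interior equations hold up to
  the axes. This includes \<open>(1, 1)\<close>: the origin belongs to both axes, feeds \<open>(1, 1)\<close> at the
  sum of their rates, and would not feed it at all in the continued interior because
  \<open>q Q 1 1 = 0\<close>. The corner equations concern \<open>(0, 1)\<close> and \<open>(1, 0)\<close>. For \<open>(0, 1)\<close> there are two
  deviations from the pattern of the vertical axis: the neighbour \<open>(1, 0)\<close> has the value \<open>h 1\<close>
  instead of \<open>y 1 0\<close>, and the origin has its own rate. They must cancel.
\<close>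

lemma compensation_balance:
  fixes y :: "nat \<Rightarrow> nat \<Rightarrow> real" and h v :: "nat \<Rightarrow> real"
  assumes nn: "nearest_neighbour Q"
    and A: "q Q 1 1 = 0" "q Q (-1) (-1) = 0"
    and origin_step: "qo Q 1 1 = qh Q 1 1 + qv Q 1 1"
    and interior: "\<And>m n. (1 - q Q 0 0) * y (m + 1) (n + 1) =
      q Q 1 0 * y m (n + 1) + q Q (-1) 0 * y (m + 2) (n + 1)
      + q Q 0 1 * y (m + 1) n + q Q 0 (-1) * y (m + 1) (n + 2)
      + q Q (-1) 1 * y (m + 2) n + q Q 1 (-1) * y m (n + 2)"
    and ver_flux: "\<And>n. qv Q 1 0 * v (n + 1) + qv Q 1 (-1) * v (n + 2) + qv Q 1 1 * v n =
      q Q 1 0 * y 0 (n + 1) + q Q 1 (-1) * y 0 (n + 2)"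
    and ver_balance: "\<And>n. (1 - qv Q 0 0) * v (n + 1) =
      qv Q 0 1 * v n + qv Q 0 (-1) * v (n + 2) + q Q (-1) 0 * y 1 (n + 1) + q Q (-1) 1 * y 1 n"
    and hor_flux: "\<And>m. qh Q 0 1 * h (m + 1) + qh Q (-1) 1 * h (m + 2) + qh Q 1 1 * h m =
      q Q 0 1 * y (m + 1) 0 + q Q (-1) 1 * y (m + 2) 0"
    and hor_balance: "\<And>m. (1 - qh Q 0 0) * h (m + 1) =
      qh Q 1 0 * h m + qh Q (-1) 0 * h (m + 2) + q Q 0 (-1) * y (m + 1) 1 + q Q 1 (-1) * y m 1"
    and corner: "h 0 = v 0"
      "qo Q 0 1 * v 0 + qh Q (-1) 1 * h 1 = qv Q 0 1 * v 0 + q Q (-1) 1 * y 1 0"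
      "qo Q 1 0 * h 0 + qv Q 1 (-1) * v 1 = qh Q 1 0 * h 0 + q Q 1 (-1) * y 0 1"
    and origin_balance: "(1 - qo Q 0 0) * v 0 = qv Q 0 (-1) * v 1 + qh Q (-1) 0 * h 1"
  defines "x \<equiv> \<lambda>(m, n). if m = 0 then v n else if n = 0 then h m else y m n"
  shows "(\<Sum>r\<in>{m - 1..m + 1} \<times> {n - 1..n + 1}. x r * pmf (walk_kernel Q r) (m, n)) = x (m, n)"
proof -
  have zero: "{0 - 1..0 + 1} = {0, 1 :: nat}" by auto
  have Suc: "{Suc k - 1..Suc k + 1} = {k, Suc k, Suc (Suc k)}" for k by auto
  have split: "(\<Sum>r\<in>{m - 1..m + 1} \<times> {n - 1..n + 1}. x r * pmf (walk_kernel Q r) (m, n)) =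
    (\<Sum>i\<in>{m - 1..m + 1}. \<Sum>j\<in>{n - 1..n + 1}.
       x (i, j) * pmf (step_law Q (i, j)) (int m - int i, int n - int j))"
    unfolding sum.cartesian_product by (rule sum.cong) (auto simp: pmf_walk_kernel[OF nn])
  consider "m = 0" "n = 0" | n' where "m = 0" "n = Suc n'" | m' where "m = Suc m'" "n = 0"
    | m' n' where "m = Suc m'" "n = Suc n'"
    by (cases m; cases n) auto
  then show ?thesis
  proof cases
    case 1
    then show ?thesis unfolding split unfolding 1 zero
      using origin_balance corner(1) A by (simp add: x_def step_law_def algebra_simps)
  next
    case 2
    then show ?thesis unfolding split unfolding 2 zero Suc
      using ver_balance[of n'] corner(1,2) A
      by (cases n'; simp add: x_def step_law_def algebra_simps)
  next
    case 3
    then show ?thesis unfolding split unfolding 3 zero Suc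
      using hor_balance[of m'] corner(1,3) A
      by (cases m'; simp add: x_def step_law_def algebra_simps)
  next
    case 4
    then show ?thesis unfolding split unfolding 4 Suc
      using interior[of m' n'] ver_flux[of n'] hor_flux[of m'] corner(1) A origin_step
      by (cases m'; cases n'; simp add: x_def step_law_def algebra_simps)
  qed
qed

section \<open>The three-term solution\<close>

text \<open>
  The three-term expression for \<open>m, n \<ge> 1\<close>, scaled so that its coefficients are polynomials in the
  parameters; the common factor of the scaling also multiplies the other coefficients of the formula.
\<close>

definition bulk :: "real \<Rightarrow> real \<Rightarrow> real \<Rightarrow> real \<Rightarrow> nat \<Rightarrow> nat \<Rightarrow> real" where
  "bulk p s e f m n =
     (1 - p) * (p * e + s * f) * (e + s * f) * (p ^ m * (p * s) ^ n)
     - (1 - p * s) * (f + p * e) * (e + s * f) * ((p * s) ^ m * (p * s) ^ n)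
     + (1 - s) * (p * e + s * f) * (f + p * e) * ((p * s) ^ m * s ^ n)"

text \<open>
  The values on the axis \<open>m = 0\<close>, in the scale of \<open>bulk\<close>. Reflection in the diagonal exchanges
  \<open>(p, e)\<close> and \<open>(s, f)\<close>, so the values on the axis \<open>n = 0\<close> are \<open>edge s p f e\<close>.
\<close>

definition edge :: "real \<Rightarrow> real \<Rightarrow> real \<Rightarrow> real \<Rightarrow> nat \<Rightarrow> real" where
  "edge p s e f n =
     p * e * (1 - s) * ((p * e + s * f) * s ^ n - p * (e + s * f) * (p * s) ^ n)"

lemma bulk_swap: "bulk s p f e n m = bulk p s e f m n"
  by (simp add: bulk_def algebra_simps)

lemma edge_0_swap: "edge s p f e 0 = edge p s e f 0"
  by (simp add: edge_def algebra_simps)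

text \<open>
  The three pairs are points of the curve of the interior equations. As a quadratic equation in \<open>\<gamma>\<close>
  for fixed \<open>\<delta>\<close>, its roots have product \<open>p * \<delta>\<close>, and by symmetry the two values of \<open>\<delta>\<close> for fixed
  \<open>\<gamma>\<close> have product \<open>s * \<gamma>\<close>: for \<open>\<delta> = p * s\<close> the root \<open>p\<close> forces the root \<open>p * s\<close>, and
  then for \<open>\<gamma> = p * s\<close> the root \<open>p * s\<close> forces the root \<open>s\<close>.
\<close>

lemma product_form_balance:
  fixes \<gamma> \<delta> p s e f :: real
  assumes "p > 0" "s > 0"
    and "(\<gamma>, \<delta>) \<in> {(p, p * s), (p * s, p * s), (p * s, s)}"
  shows "(p * e + f / p + s * f + e / s + e + f) * (\<gamma> * \<delta>) =
    p * e * \<delta> + f / p * \<gamma>\<^sup>2 * \<delta> + s * f * \<gamma> + e / s * \<gamma> * \<delta>\<^sup>2 + e * \<gamma>\<^sup>2 + f * \<delta>\<^sup>2"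
  using assms by (auto simp: field_simps power2_eq_square)

lemma product_form_balance_pow:
  fixes \<gamma> \<delta> p s e f :: real
  assumes "p > 0" "s > 0"
    and "(\<gamma>, \<delta>) \<in> {(p, p * s), (p * s, p * s), (p * s, s)}"
  defines "y \<equiv> \<lambda>m n. \<gamma> ^ m * \<delta> ^ n"
  shows "(p * e + f / p + s * f + e / s + e + f) * y (m + 1) (n + 1) =
    p * e * y m (n + 1) + f / p * y (m + 2) (n + 1) + s * f * y (m + 1) n
    + e / s * y (m + 1) (n + 2) + e * y (m + 2) n + f * y m (n + 2)"
  using arg_cong[OF product_form_balance[OF assms(1,2,3), of e f], of "\<lambda>z. z * (\<gamma> ^ m * \<delta> ^ n)"]
  by (simp add: y_def algebra_simps power2_eq_square)

lemma bulk_balance: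
  fixes p s e f :: real
  assumes "p > 0" "s > 0"
  defines "y \<equiv> bulk p s e f"
  shows "(p * e + f / p + s * f + e / s + e + f) * y (m + 1) (n + 1) =
    p * e * y m (n + 1) + f / p * y (m + 2) (n + 1) + s * f * y (m + 1) n
    + e / s * y (m + 1) (n + 2) + e * y (m + 2) n + f * y m (n + 2)"
proof -
  note P = product_form_balance_pow[OF assms(1,2), of _ _ e f m n]
  \<comment> \<open>The interior equations are linear: a combination of three solutions is a solution.\<close>
  have lin: "T * (A * u1 - B * v1 + C * w1) = k1 * (A * u2 - B * v2 + C * w2)
      + k2 * (A * u3 - B * v3 + C * w3) + k3 * (A * u4 - B * v4 + C * w4)
      + k4 * (A * u5 - B * v5 + C * w5) + k5 * (A * u6 - B * v6 + C * w6)
      + k6 * (A * u7 - B * v7 + C * w7)"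
    if "T * u1 = k1 * u2 + k2 * u3 + k3 * u4 + k4 * u5 + k5 * u6 + k6 * u7"
      "T * v1 = k1 * v2 + k2 * v3 + k3 * v4 + k4 * v5 + k5 * v6 + k6 * v7"
      "T * w1 = k1 * w2 + k2 * w3 + k3 * w4 + k4 * w5 + k5 * w6 + k6 * w7"
    for T A B C k1 k2 k3 k4 k5 k6 u1 u2 u3 u4 u5 u6 u7 v1 v2 v3 v4 v5 v6 v7
      w1 w2 w3 w4 w5 w6 w7 :: real
  proof -
    have "T * (A * u1 - B * v1 + C * w1) = A * (T * u1) - B * (T * v1) + C * (T * w1)"
      by (simp add: algebra_simps)
    then show ?thesis unfolding that by (simp add: algebra_simps)
  qed
  show ?thesis
    unfolding y_def bulk_def by (rule lin; rule P; simp)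
qed

text \<open>
  The flux equation of the vertical axis. It separates into one equation for the powers of \<open>p * s\<close>,
  where the first two terms of \<open>bulk\<close> meet, and one for the powers of \<open>s\<close>, where the third term is
  alone. The rate \<open>p * e + s * f * f / (p * e)\<close> is the one that Condition D gives for the step
  \<open>(1, 0)\<close> from this axis.
\<close>

lemma edge_into_bulk:
  fixes p s e f :: real
  assumes "p > 0" "e > 0"
  defines "x \<equiv> edge p s e f" and "y \<equiv> bulk p s e f 0"
  shows "(p * e + s * f * f / (p * e)) * x (n + 1) + f * x (n + 2) + s * f * x n
    = p * e * y (n + 1) + f * y (n + 2)"
  using assms(1,2) unfolding x_def y_def edge_def bulk_def
  by (simp add: field_simps)

lemma edge_balance:
  fixes p s e f :: real
  assumes "p > 0" "s > 0" "e > 0"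
  defines "x \<equiv> edge p s e f" and "y \<equiv> bulk p s e f 1"
  shows "(s * f + e + e / s + f + p * e + s * f * f / (p * e)) * x (n + 1)
    = e * x n + e / s * x (n + 2) + f / p * y (n + 1) + e * y n"
  using assms(1-3) unfolding x_def y_def edge_def bulk_def
  by (simp add: field_simps)

text \<open>
  The deviation at the corner: \<open>s * f * f / (p * e)\<close> is the excess of the rate of the step \<open>(1, 0)\<close>
  from the origin over that from the horizontal axis, as given by Conditions B.2 and D.
\<close>

lemma edge_corner:
  fixes p s e f :: real
  assumes "p > 0" "e > 0"
  defines "x \<equiv> edge p s e f"
  shows "s * f * f / (p * e) * x 0 + f * x 1 = f * bulk p s e f 0 1"
  using assms(1,2) unfolding x_def edge_def bulk_def
  by (simp add: field_simps)

lemma origin_balance: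
  fixes p s e f :: real
  assumes "p > 0" "s > 0" "e > 0" "f > 0"
  shows "(e + p * e * e / (s * f) + (f + s * f * f / (p * e)) + (p * e + s * f)) * edge p s e f 0
    = e / s * edge p s e f 1 + f / p * edge s p f e 1"
  using assms unfolding edge_def
  by (simp add: field_simps)

section \<open>Positivity and summability\<close>

lemma edge_pos:
  assumes "0 < p" "p < 1" "0 < s" "s < 1" "0 < e" "0 < f"
  shows "edge p s e f n > 0"
proof -
  have "edge p s e f n = p * e * (1 - s) * s ^ n * (p * e * (1 - p ^ n) + s * f * (1 - p * p ^ n))"
    by (simp add: edge_def power_mult_distrib algebra_simps)
  moreover have "p * p ^ n < 1" using power_Suc_less_one assms by force
  moreover have "p ^ n \<le> 1" using assms by (simp add: power_le_one)
  ultimately show ?thesis using assms by (simp add: add_nonneg_pos)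
qed

text \<open>
  Divided by \<open>p ^ m * s ^ n\<close>, the value is \<open>A * u - B * (u * v) + D * v\<close> with \<open>u = p ^ n \<le> p\<close> and
  \<open>v = s ^ m \<le> s\<close>. Divided further by \<open>u * v\<close> it is \<open>A / v + D / u - B\<close>, which is smallest at
  \<open>u = p\<close>, \<open>v = s\<close>, the case \<open>m = n = 1\<close>. There it is a positive multiple of a sum of
  positive terms.
\<close>

lemma bulk_pos:
  assumes "0 < p" "p < 1" "0 < s" "s < 1" "0 < e" "0 < f" "m > 0" "n > 0"
  shows "bulk p s e f m n > 0"
proof -
  define A where "A = (1 - p) * (p * e + s * f) * (e + s * f)"
  define B where "B = (1 - p * s) * (f + p * e) * (e + s * f)"
  define D where "D = (1 - s) * (p * e + s * f) * (f + p * e)"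
  define u where "u = p ^ n"
  define v where "v = s ^ m"
  have AD: "A > 0" "D > 0" using assms by (simp_all add: A_def D_def add_pos_pos)
  have u: "0 < u" "u \<le> p" using assms power_decreasing[of 1 n p] by (simp_all add: u_def)
  have v: "0 < v" "v \<le> s" using assms power_decreasing[of 1 m s] by (simp_all add: v_def)
  have "A * p - B * (p * s) + D * s = (1 - p) * (1 - s) *
      ((1 + p) * (s * f)\<^sup>2 + (1 + s) * (p * e)\<^sup>2 + (1 + p) * (1 + s) * (p * e) * (s * f))"
    by (simp add: A_def B_def D_def power2_eq_square algebra_simps)
  also have "\<dots> > 0" using assms by (simp add: add_pos_pos)
  finally have pos: "A * p - B * (p * s) + D * s > 0" .
  have "0 < u * v * (A * p - B * (p * s) + D * s)" using pos u v by simp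
  also have "\<dots> = A * u * p * v - B * u * v * (p * s) + D * v * s * u"
    by (simp add: algebra_simps)
  also have "\<dots> \<le> A * u * p * s - B * u * v * (p * s) + D * v * s * p"
    using AD u v assms by (intro add_mono diff_right_mono mult_left_mono) auto
  also have "\<dots> = p * s * (A * u - B * (u * v) + D * v)" by (simp add: algebra_simps)
  finally have "A * u - B * (u * v) + D * v > 0"
    using assms mult_pos_pos[of p s] zero_less_mult_pos[of "p * s"] by blast
  moreover have "bulk p s e f m n = p ^ m * s ^ n * (A * u - B * (u * v) + D * v)"
    by (simp add: bulk_def A_def B_def D_def u_def v_def power_mult_distrib algebra_simps)
  ultimately show ?thesis using assms by simp
qed

definition weight :: "real \<Rightarrow> real \<Rightarrow> real \<Rightarrow> real \<Rightarrow> nat \<times> nat \<Rightarrow> real" where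
  "weight p s e f = (\<lambda>(m, n).
     if m = 0 then edge p s e f n else if n = 0 then edge s p f e m else bulk p s e f m n)"

lemma weight_pos:
  assumes "0 < p" "p < 1" "0 < s" "s < 1" "0 < e" "0 < f"
  shows "weight p s e f r > 0"
  using assms by (cases r) (auto simp: weight_def edge_pos bulk_pos)

lemma pmf_of_has_sum_1:
  fixes f :: "'s \<Rightarrow> real"
  assumes "\<And>s. f s \<ge> 0" "(f has_sum 1) UNIV"
  obtains \<pi> where "\<And>s. pmf \<pi> s = f s"
proof -
  have "(\<lambda>s. norm (f s)) summable_on UNIV" using assms by (auto simp: summable_on_def)
  then have abs: "Infinite_Set_Sum.abs_summable_on f UNIV"
    by (rule abs_summable_equivalent[THEN iffD1])
  have "infsetsum f UNIV = 1"
    using infsetsum_infsum[OF abs] infsumI[OF assms(2)] by simp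
  then have "(\<integral>\<^sup>+s. ennreal (f s) \<partial>count_space UNIV) = 1"
    using nn_integral_conv_infsetsum[OF abs] assms(1) by simp
  then have "pmf (embed_pmf f) s = f s" for s
    using assms(1) by (intro pmf_embed_pmf) auto
  then show ?thesis using that by blast
qed

lemma summable_on_geometric_product:
  fixes a b :: real
  assumes "0 \<le> a" "a < 1" "0 \<le> b" "b < 1"
  shows "(\<lambda>(m, n). a ^ m * b ^ n) summable_on UNIV"
proof -
  have g: "((\<lambda>n. c ^ n) has_sum (1 / (1 - c))) UNIV" if "0 \<le> c" "c < 1" for c :: real
    using that by (intro sums_nonneg_imp_has_sum) (auto intro!: geometric_sums)
  have "((\<lambda>n. a ^ m * b ^ n) has_sum (a ^ m * (1 / (1 - b)))) UNIV" for m
    using g[OF assms(3,4)] by (rule has_sum_cmult_right)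
  moreover have "(\<lambda>m. a ^ m * (1 / (1 - b))) summable_on UNIV"
    using has_sum_cmult_left[OF g[OF assms(1,2)]] by (rule has_sum_imp_summable)
  ultimately have "(\<lambda>(m, n). a ^ m * b ^ n) summable_on (UNIV \<times> (UNIV :: nat set))"
    using assms by (intro summable_on_SigmaI[where g = "\<lambda>m. a ^ m * (1 / (1 - b))"]) auto
  then show ?thesis by simp
qed

text \<open>
All terms are dominated by multiples of \<open>p ^ m * s ^ n\<close>, since \<open>(p * s) ^ n\<close> is below both powers.
\<close>

lemma weight_summable:
  assumes "0 < p" "p < 1" "0 < s" "s < 1" "0 < e" "0 < f"
  shows "weight p s e f summable_on UNIV"
proof -
  define A where "A = (1 - p) * (p * e + s * f) * (e + s * f)"
  define D where "D = (1 - s) * (p * e + s * f) * (f + p * e)"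
  define V where "V = p * e * (1 - s) * (p * e + s * f)"
  define H where "H = s * f * (1 - p) * (s * f + p * e)"
  have nonneg: "A \<ge> 0" "D \<ge> 0" "V \<ge> 0" "H \<ge> 0"
    using assms by (simp_all add: A_def D_def V_def H_def)
  have pow: "(p * s) ^ n \<le> s ^ n" "(p * s) ^ n \<le> p ^ n" for n
    using assms by (simp_all add: power_mult_distrib mult_le_cancel_right1 mult_le_cancel_left1 power_le_one)
  have bulk: "bulk p s e f m n \<le> (A + D) * (p ^ m * s ^ n)" for m n
  proof -
    have "bulk p s e f m n \<le> A * (p ^ m * (p * s) ^ n) + D * ((p * s) ^ m * s ^ n)"
      using assms mult_strict_mono[of p 1 s 1] by (simp add: bulk_def A_def D_def)
    also have "\<dots> \<le> A * (p ^ m * s ^ n) + D * (p ^ m * s ^ n)"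
      using pow assms nonneg by (intro add_mono mult_left_mono mult_right_mono) auto
    finally show ?thesis by (simp add: algebra_simps)
  qed
  have edge_le: "edge p s e f n \<le> V * s ^ n" "edge s p f e n \<le> H * p ^ n" for n
    using assms by (simp_all add: edge_def V_def H_def right_diff_distrib mult.assoc)
  have "(\<lambda>r. (A + D + V + H) * (case r of (m, n) \<Rightarrow> p ^ m * s ^ n)) summable_on UNIV"
    using assms by (intro summable_on_cmult_right summable_on_geometric_product) auto
  then show ?thesis
  proof (rule summable_on_comparison_test)
    fix r :: "nat \<times> nat"
    obtain m n where r: "r = (m, n)" by fastforce
    have "V * s ^ n \<le> (A + D + V + H) * s ^ n" "H * p ^ m \<le> (A + D + V + H) * p ^ m"
      "(A + D) * (p ^ m * s ^ n) \<le> (A + D + V + H) * (p ^ m * s ^ n)"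
      using nonneg assms by (intro mult_right_mono; simp)+
    then show "weight p s e f r \<le> (A + D + V + H) * (case r of (m, n) \<Rightarrow> p ^ m * s ^ n)"
      using edge_le[of n] edge_le[of m] bulk[of m n] by (auto simp: weight_def r)
    show "0 \<le> weight p s e f r" using weight_pos[OF assms] less_imp_le by blast
  qed
qed

section \<open>Walks with a three-term stationary distribution\<close>

text \<open>
  Condition C is built into \<open>int_rates\<close>: opposite steps have rates with product \<open>e * f\<close>.
\<close>

locale geometric_walk =
  fixes Q :: walk and p s e f :: real
  assumes nn: "nearest_neighbour Q"
    and conds: "cond_A Q" "cond_B1 Q" "cond_B2 Q" "cond_D Q"
    and params: "0 < p" "p < 1" "0 < s" "s < 1" "0 < e" "0 < f"
    and int_rates: "q Q 1 0 = p * e" "q Q (-1) 0 = f / p" "q Q 0 1 = s * f" "q Q 0 (-1) = e / s"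
      "q Q (-1) 1 = e" "q Q 1 (-1) = f"
begin

lemma \<rho>_eq: "\<rho>1 Q = p" "\<rho>2 Q = s"
proof -
  have "f / p + e > 0" "e / s + f > 0" using params by (simp_all add: add_pos_pos)
  then show "\<rho>1 Q = p" "\<rho>2 Q = s"
    using params by (simp_all add: \<rho>1_def \<rho>2_def int_rates divide_eq_eq distrib_left add.commute)
qed

lemma ver_rates:
  "qv Q 1 1 = s * f" "qv Q 0 1 = e" "qv Q 0 (-1) = e / s" "qv Q 1 (-1) = f"
  "qv Q 1 0 = p * e + s * f * f / (p * e)"
  using conds by (simp_all add: cond_B1_def cond_D_def int_rates mult_ac)

lemma hor_rates:
  "qh Q 1 1 = p * e" "qh Q 1 0 = f" "qh Q (-1) 0 = f / p" "qh Q (-1) 1 = e"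
  "qh Q 0 1 = s * f + p * e * e / (s * f)"
  using conds by (simp_all add: cond_B1_def cond_D_def int_rates mult_ac)

lemma org_rates:
  "qo Q 0 1 = e + p * e * e / (s * f)" "qo Q 1 0 = f + s * f * f / (p * e)" "qo Q 1 1 = p * e + s * f"
  using conds by (simp_all add: cond_B2_def int_rates ver_rates hor_rates)

lemma stay_rates:
  "1 - q Q 0 0 = p * e + f / p + s * f + e / s + e + f"
  "1 - qv Q 0 0 = s * f + e + e / s + f + p * e + s * f * f / (p * e)"
  "1 - qh Q 0 0 = p * e + f + f / p + e + s * f + p * e * e / (s * f)"
  "1 - qo Q 0 0 = e + p * e * e / (s * f) + (f + s * f * f / (p * e)) + (p * e + s * f)"
proof -
  have total: "(\<Sum>k\<in>A. \<Sum>l\<in>B. pmf P (k, l)) = 1" if "set_pmf P \<subseteq> A \<times> B" "finite A" "finite B"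
    for P :: "(int \<times> int) pmf" and A B
    using sum_pmf_eq_1[OF _ that(1)] that by (simp add: sum.cartesian_product)
  note N = nn[unfolded nearest_neighbour_def]
  show "1 - q Q 0 0 = p * e + f / p + s * f + e / s + e + f"
    using total[of "int_step Q" "{-1, 0, 1}" "{-1, 0, 1}"] N conds(1)
    by (simp add: cond_A_def int_rates)
  show "1 - qv Q 0 0 = s * f + e + e / s + f + p * e + s * f * f / (p * e)"
    using total[of "ver_step Q" "{0, 1}" "{-1, 0, 1}"] N by (simp add: ver_rates)
  show "1 - qh Q 0 0 = p * e + f + f / p + e + s * f + p * e * e / (s * f)"
    using total[of "hor_step Q" "{-1, 0, 1}" "{0, 1}"] N by (simp add: hor_rates)
  show "1 - qo Q 0 0 = e + p * e * e / (s * f) + (f + s * f * f / (p * e)) + (p * e + s * f)"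
    using total[of "org_step Q" "{0, 1}" "{0, 1}"] N by (simp add: org_rates)
qed

lemma weight_balance:
  "(\<Sum>r\<in>{m - 1..m + 1} \<times> {n - 1..n + 1}. weight p s e f r * pmf (walk_kernel Q r) (m, n))
     = weight p s e f (m, n)"
  unfolding weight_def
proof (rule compensation_balance[OF nn])
  show "q Q 1 1 = 0" "q Q (-1) (-1) = 0" using conds by (simp_all add: cond_A_def)
  show "qo Q 1 1 = qh Q 1 1 + qv Q 1 1" by (simp add: org_rates hor_rates ver_rates)
qed (unfold stay_rates int_rates ver_rates hor_rates org_rates,
    use params bulk_balance[of p s e f] edge_into_bulk[of p e s f] edge_balance[of p s e f]
      edge_into_bulk[of s f p e] edge_balance[of s p f e] edge_0_swap[of s p f e]
      edge_corner[of p e s f] edge_corner[of s f p e] origin_balance[of p s e f]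
      bulk_swap[of s p f e] in
      \<open>simp_all add: algebra_simps\<close>)

text \<open>
  The factored numerators and denominators of the coefficients that belong to the vertical axis. The
  factors are positive, and the denominators \<open>p * e\<close> cancel in the quotients.
\<close>

lemma ver_factors:
  "V_E Q (\<delta>0 Q) / \<gamma>0 Q + L_poly Q (\<delta>0 Q) = (1 - p) * (p * e + s * f) * (e + s * f) / (p * e)"
  "V_E Q (\<delta>0 Q) / \<gamma>1 Q + L_poly Q (\<delta>0 Q) = (1 - p * s) * (f + p * e) * (e + s * f) / (p * e)"
  "Q_E Q (\<delta>0 Q) * (1 / \<gamma>1 Q - 1 / \<gamma>0 Q) = p * (1 - s) * (e + s * f)"
  "Q_E Q (\<delta>1 Q) / V_E Q (\<delta>1 Q) = p * e / (f + p * e)"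
proof -
  have L: "L_poly Q d = e / s * d\<^sup>2 - (s * f + e + e / s + f + p * e + s * f * f / (p * e)) * d + e" for d
    by (simp add: L_poly_def ver_rates stay_rates)
  show "V_E Q (\<delta>0 Q) / \<gamma>0 Q + L_poly Q (\<delta>0 Q) = (1 - p) * (p * e + s * f) * (e + s * f) / (p * e)"
    "V_E Q (\<delta>0 Q) / \<gamma>1 Q + L_poly Q (\<delta>0 Q) = (1 - p * s) * (f + p * e) * (e + s * f) / (p * e)"
    using params unfolding V_E_def L \<delta>0_def \<gamma>0_def \<gamma>1_def \<rho>_eq ver_rates
    by (simp_all add: field_simps power2_eq_square)
  show "Q_E Q (\<delta>0 Q) * (1 / \<gamma>1 Q - 1 / \<gamma>0 Q) = p * (1 - s) * (e + s * f)"
    using params unfolding Q_E_def \<delta>0_def \<gamma>0_def \<gamma>1_def \<rho>_eq int_rates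
    by (simp_all add: field_simps power2_eq_square)
  have "V_E Q s = s * (s * f + p * e) * (f + p * e) / (p * e)" "Q_E Q s = s * (s * f + p * e)"
    using params unfolding V_E_def Q_E_def ver_rates int_rates
    by (simp_all add: field_simps power2_eq_square)
  moreover have "s * f + p * e \<noteq> 0" using params by (simp add: add_pos_pos less_imp_neq[symmetric])
  ultimately show "Q_E Q (\<delta>1 Q) / V_E Q (\<delta>1 Q) = p * e / (f + p * e)"
    using params by (simp add: \<delta>1_def \<rho>_eq)
qed

lemma hor_factors:
  "H_N Q (\<gamma>1 Q) / \<delta>1 Q + W_poly Q (\<gamma>1 Q) = (1 - s) * (p * e + s * f) * (f + p * e) / (s * f)"
  "H_N Q (\<gamma>1 Q) / \<delta>0 Q + W_poly Q (\<gamma>1 Q) = (1 - p * s) * (f + p * e) * (e + s * f) / (s * f)"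
  "Q_N Q (\<gamma>1 Q) * (1 / \<delta>1 Q - 1 / \<delta>0 Q) = - (s * (1 - p) * (f + p * e))"
  "Q_N Q (\<gamma>0 Q) / H_N Q (\<gamma>0 Q) = s * f / (e + s * f)"
proof -
  have W: "W_poly Q g = f / p * g\<^sup>2 - (p * e + f + f / p + e + s * f + p * e * e / (s * f)) * g + f" for g
    by (simp add: W_poly_def hor_rates stay_rates)
  show "H_N Q (\<gamma>1 Q) / \<delta>1 Q + W_poly Q (\<gamma>1 Q) = (1 - s) * (p * e + s * f) * (f + p * e) / (s * f)"
    "H_N Q (\<gamma>1 Q) / \<delta>0 Q + W_poly Q (\<gamma>1 Q) = (1 - p * s) * (f + p * e) * (e + s * f) / (s * f)"
    using params unfolding H_N_def W \<delta>0_def \<delta>1_def \<gamma>1_def \<rho>_eq hor_rates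
    by (simp_all add: field_simps power2_eq_square)
  show "Q_N Q (\<gamma>1 Q) * (1 / \<delta>1 Q - 1 / \<delta>0 Q) = - (s * (1 - p) * (f + p * e))"
    using params unfolding Q_N_def \<delta>0_def \<delta>1_def \<gamma>1_def \<rho>_eq int_rates
    by (simp_all add: field_simps power2_eq_square)
  have "H_N Q p = p * (p * e + s * f) * (e + s * f) / (s * f)" "Q_N Q p = p * (p * e + s * f)"
    using params unfolding H_N_def Q_N_def hor_rates int_rates
    by (simp_all add: field_simps power2_eq_square)
  moreover have "p * e + s * f \<noteq> 0" using params by (simp add: add_pos_pos less_imp_neq[symmetric])
  ultimately show "Q_N Q (\<gamma>0 Q) / H_N Q (\<gamma>0 Q) = s * f / (e + s * f)"
    using params by (simp add: \<gamma>0_def \<rho>_eq)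
qed

text \<open>
  The prescribed \<open>c0\<close> is the first coefficient of \<open>bulk\<close>. The other five are then the remaining
  coefficients of \<open>bulk\<close> and those of \<open>edge\<close> for the two axes.
\<close>

lemma coefs:
  fixes t :: real
  defines "c0 \<equiv> t * ((1 - p) * (p * e + s * f) * (e + s * f))"
  shows "coef_c1 Q c0 = - (t * ((1 - p * s) * (f + p * e) * (e + s * f)))"
    and "coef_d1 Q c0 = t * ((1 - s) * (p * e + s * f) * (f + p * e))"
    and "coef_e0 Q c0 = t * (s * f * (1 - p) * (p * e + s * f))"
    and "coef_e1 Q c0 = - (t * (s\<^sup>2 * f * (1 - p) * (f + p * e)))"
    and "coef_z1 Q c0 = - (t * (p\<^sup>2 * e * (1 - s) * (e + s * f)))"
    and "coef_z2 Q c0 = t * (p * e * (1 - s) * (p * e + s * f))"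
proof -
  have nz: "p * e + s * f \<noteq> 0" "e + s * f \<noteq> 0" "f + p * e \<noteq> 0" "1 - p * s \<noteq> 0"
    using params mult_strict_mono[of p 1 s 1] by (auto simp: add_pos_pos less_imp_neq[symmetric])
  show c1: "coef_c1 Q c0 = - (t * ((1 - p * s) * (f + p * e) * (e + s * f)))"
    using nz params unfolding coef_c1_def ver_factors c0_def by simp
  show d1: "coef_d1 Q c0 = t * ((1 - s) * (p * e + s * f) * (f + p * e))"
    using nz params unfolding coef_d1_def hor_factors c1 by simp
  show "coef_e0 Q c0 = t * (s * f * (1 - p) * (p * e + s * f))"
    using nz params unfolding coef_e0_def hor_factors c0_def by simp
  show "coef_e1 Q c0 = - (t * (s\<^sup>2 * f * (1 - p) * (f + p * e)))"
    using nz params unfolding coef_e1_def hor_factors c1 by (simp add: power2_eq_square)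
  show "coef_z1 Q c0 = - (t * (p\<^sup>2 * e * (1 - s) * (e + s * f)))"
    using nz params unfolding coef_z1_def ver_factors c0_def by (simp add: power2_eq_square)
  show "coef_z2 Q c0 = t * (p * e * (1 - s) * (p * e + s * f))"
    using nz params unfolding coef_z2_def ver_factors d1 by simp
qed

lemma weight_closed_form:
  fixes t :: real
  defines "c0 \<equiv> t * ((1 - p) * (p * e + s * f) * (e + s * f))"
  shows "m > 0 \<Longrightarrow> n > 0 \<Longrightarrow> t * weight p s e f (m, n) =
      c0 * \<rho>1 Q ^ m * (\<rho>1 Q * \<rho>2 Q) ^ n + coef_c1 Q c0 * (\<rho>1 Q * \<rho>2 Q) ^ (m + n)
      + coef_d1 Q c0 * (\<rho>1 Q * \<rho>2 Q) ^ m * \<rho>2 Q ^ n"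
    and "t * weight p s e f (0, n) = coef_z1 Q c0 * (\<rho>1 Q * \<rho>2 Q) ^ n + coef_z2 Q c0 * \<rho>2 Q ^ n"
    and "t * weight p s e f (m, 0) = coef_e0 Q c0 * \<rho>1 Q ^ m + coef_e1 Q c0 * (\<rho>1 Q * \<rho>2 Q) ^ m"
proof -
  note C = coefs[of t, folded c0_def]
  show "t * weight p s e f (m, n) =
      c0 * \<rho>1 Q ^ m * (\<rho>1 Q * \<rho>2 Q) ^ n + coef_c1 Q c0 * (\<rho>1 Q * \<rho>2 Q) ^ (m + n)
      + coef_d1 Q c0 * (\<rho>1 Q * \<rho>2 Q) ^ m * \<rho>2 Q ^ n" if "m > 0" "n > 0"
    using that unfolding C \<rho>_eq by (simp add: c0_def weight_def bulk_def power_add algebra_simps)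
  show "t * weight p s e f (0, n) = coef_z1 Q c0 * (\<rho>1 Q * \<rho>2 Q) ^ n + coef_z2 Q c0 * \<rho>2 Q ^ n"
    unfolding C \<rho>_eq by (simp add: weight_def edge_def power2_eq_square algebra_simps)
  have row: "weight p s e f (m, 0) = edge s p f e m"
    using edge_0_swap[of s p f e] by (simp add: weight_def)
  show "t * weight p s e f (m, 0) = coef_e0 Q c0 * \<rho>1 Q ^ m + coef_e1 Q c0 * (\<rho>1 Q * \<rho>2 Q) ^ m"
    unfolding C \<rho>_eq row by (simp add: edge_def power2_eq_square algebra_simps)
qed

lemma x_form_eq_weight:
  "x_form Q (t * ((1 - p) * (p * e + s * f) * (e + s * f))) m n = t * weight p s e f (m, n)"
proof (cases "m = 0")
  case True
  then show ?thesis using weight_closed_form(2)[of t n] by (simp add: x_form_def)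
next
  case False
  then show ?thesis
    using weight_closed_form(1)[of m n t] weight_closed_form(3)[of t m]
    by (cases "n = 0") (simp_all add: x_form_def)
qed

end

text \<open>
  The walk must be able to move left and down. If the common product of Condition C were zero,
  then the rates of \<open>(-1, 0)\<close> and \<open>(0, -1)\<close> would vanish, so that only the two
  diagonal steps could do this; then both would be positive and their product nonzero. With a
  nonzero product, the rates of \<open>(-1, 0)\<close> and \<open>(0, -1)\<close> can be eliminated, which reduces \<open>\<rho>1\<close> and
  \<open>\<rho>2\<close> to quotients of two rates.
\<close>

lemma geometric_walkI:
  assumes nn: "nearest_neighbour Q" and irr: "irreducible_chain (walk_kernel Q)"
    and conds: "cond_A Q" "cond_B1 Q" "cond_B2 Q" "cond_C Q" "cond_D Q"
    and \<rho>: "\<rho>1 Q < 1" "\<rho>2 Q < 1"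
  shows "geometric_walk Q (\<rho>1 Q) (\<rho>2 Q) (q Q (-1) 1) (q Q 1 (-1))"
proof -
  \<comment> \<open>East, west, north, south, north-west and south-east.\<close>
  define a b c d e f where rates: "a = q Q 1 0" "b = q Q (-1) 0" "c = q Q 0 1" "d = q Q 0 (-1)"
    "e = q Q (-1) 1" "f = q Q 1 (-1)"
  have ac: "a > 0" "c > 0"
    using conds by (auto simp: rates cond_D_def order_less_le)
  have nonneg: "b \<ge> 0" "d \<ge> 0" "e \<ge> 0" "f \<ge> 0" by (simp_all add: rates)
  have C: "a * b = e * f" "c * d = e * f"
    using conds(4) by (auto simp: rates cond_C_def)
  have supp: "pmf (int_step Q) z = 0" if "z \<notin> {-1, 0, 1} \<times> {-1, 0, 1}" for z
    using nn that by (auto simp: nearest_neighbour_def set_pmf_iff)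
  have supp_h: "pmf (hor_step Q) z = 0" if "z \<notin> {-1, 0, 1} \<times> {0, 1}" for z
    using nn that by (auto simp: nearest_neighbour_def set_pmf_iff)
  have supp_v: "pmf (ver_step Q) z = 0" if "z \<notin> {0, 1} \<times> {-1, 0, 1}" for z
    using nn that by (auto simp: nearest_neighbour_def set_pmf_iff)
  obtain l where l: "q Q (-1) l > 0 \<or> qh Q (-1) l > 0"
    using irreducible_walk_steps_left[OF nn irr] by blast
  have "l \<in> {-1, 0, 1}"
  proof (rule ccontr)
    assume "l \<notin> {-1, 0, 1}"
    then have "pmf (int_step Q) (-1, l) = 0" "pmf (hor_step Q) (-1, l) = 0"
      by (auto intro!: supp supp_h)
    with l show False by simp
  qed
  then have be: "b > 0 \<or> e > 0"
    using l conds(1,2) supp_h[of "(-1, -1)"] by (auto simp: rates cond_A_def cond_B1_def)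
  obtain k where k: "q Q k (-1) > 0 \<or> qv Q k (-1) > 0"
    using irreducible_walk_steps_down[OF nn irr] by blast
  have "k \<in> {-1, 0, 1}"
  proof (rule ccontr)
    assume "k \<notin> {-1, 0, 1}"
    then have "pmf (int_step Q) (k, -1) = 0" "pmf (ver_step Q) (k, -1) = 0"
      by (auto intro!: supp supp_v)
    with k show False by simp
  qed
  then have df: "d > 0 \<or> f > 0"
    using k conds(1,2) supp_v[of "(-1, -1)"] by (auto simp: rates cond_A_def cond_B1_def)
  have "e * f \<noteq> 0"
  proof
    assume "e * f = 0"
    then have "b = 0" "d = 0" using C ac by auto
    then show False using be df \<open>e * f = 0\<close> by auto
  qed
  then have ef: "e > 0" "f > 0" using nonneg by auto
  have bd: "b = e * f / a" "d = e * f / c" using C ac by (simp_all add: field_simps)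
  have \<rho>1: "\<rho>1 Q = a / e"
  proof -
    have "b + e = (a + f) * e / a" using ac by (simp add: bd field_simps)
    then show ?thesis using ac ef by (simp add: \<rho>1_def flip: rates)
  qed
  have \<rho>2: "\<rho>2 Q = c / f"
  proof -
    have "d + f = (c + e) * f / c" using ac by (simp add: bd field_simps)
    then show ?thesis using ac ef by (simp add: \<rho>2_def flip: rates)
  qed
  show ?thesis
  proof
    show "0 < \<rho>1 Q" "0 < \<rho>2 Q" using ac ef by (simp_all add: \<rho>1 \<rho>2)
  qed (use assms ac ef bd in \<open>simp_all add: \<rho>1 \<rho>2 field_simps flip: rates\<close>)
qed

theorem theorem11:
  fixes Q :: walk
  assumes "nearest_neighbour Q"
    and "irreducible_chain (walk_kernel Q)"
    and "aperiodic_chain (walk_kernel Q)"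
    and "cond_A Q" and "cond_B1 Q" and "cond_B2 Q" and "cond_C Q" and "cond_D Q"
    and "\<rho>1 Q < 1" and "\<rho>2 Q < 1"
  shows "\<exists>\<pi> c0.
     (\<forall>\<pi>'. stationary_distribution (walk_kernel Q) \<pi>' \<longleftrightarrow> \<pi>' = \<pi>) \<and>
     (\<forall>c. ((\<lambda>(m, n). x_form Q c m n) has_sum 1) UNIV \<longleftrightarrow> c = c0) \<and>
     (\<forall>m n. m > 0 \<longrightarrow> n > 0 \<longrightarrow>
        pmf \<pi> (m, n) =
          c0 * \<rho>1 Q ^ m * (\<rho>1 Q * \<rho>2 Q) ^ n
          + coef_c1 Q c0 * (\<rho>1 Q * \<rho>2 Q) ^ (m + n)
          + coef_d1 Q c0 * (\<rho>1 Q * \<rho>2 Q) ^ m * \<rho>2 Q ^ n) \<and>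
     (\<forall>n. pmf \<pi> (0, n) =
          coef_z1 Q c0 * (\<rho>1 Q * \<rho>2 Q) ^ n + coef_z2 Q c0 * \<rho>2 Q ^ n) \<and>
     (\<forall>m. pmf \<pi> (m, 0) =
          coef_e0 Q c0 * \<rho>1 Q ^ m + coef_e1 Q c0 * (\<rho>1 Q * \<rho>2 Q) ^ m)"
proof -
  define p s e f where param_defs: "p = \<rho>1 Q" "s = \<rho>2 Q" "e = q Q (-1) 1" "f = q Q 1 (-1)"
  interpret geometric_walk Q p s e f
    unfolding param_defs using geometric_walkI assms by blast
  define A where "A = (1 - p) * (p * e + s * f) * (e + s * f)"
  define w where "w = weight p s e f"
  have A: "A > 0" using params unfolding A_def by (simp add: add_pos_pos)
  have w_pos: "w r > 0" for r
    unfolding w_def using weight_pos params by blast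
  obtain S where S: "(w has_sum S) UNIV"
    using weight_summable[OF params] unfolding w_def summable_on_def by blast
  have "S > 0"
  proof (rule ccontr)
    assume "\<not> S > 0"
    then have "w (0, 0) = 0"
      using nonneg_has_sum_le_0D[OF S] less_imp_le[OF w_pos] by simp
    with w_pos[of "(0, 0)"] show False by simp
  qed
  have unit: "((\<lambda>r. 1 / S * w r) has_sum 1) UNIV"
    using has_sum_cmult_right[OF S, of "1 / S"] \<open>S > 0\<close> by simp
  then obtain \<pi> where \<pi>: "\<And>r. pmf \<pi> r = 1 / S * w r"
    using pmf_of_has_sum_1[of "\<lambda>r. 1 / S * w r"] w_pos \<open>S > 0\<close>
    by (metis divide_nonneg_pos less_imp_le mult_nonneg_nonneg zero_le_one)
  \<comment> \<open>The formula with first coefficient \<open>c\<close> is \<open>w\<close> times \<open>c / A\<close>, and \<open>w\<close> has total mass \<open>S\<close>.\<close>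
  define c0 where "c0 = 1 / S * A"
  note closed = weight_closed_form[where t = "1 / S", folded A_def, folded c0_def w_def]
  have stationary: "stationary_distribution (walk_kernel Q) \<pi>"
  proof (subst stationary_distribution_iff_finite_sums
      [where P = "\<lambda>(m, n). {m - 1..m + 1} \<times> {n - 1..n + 1}"])
    show "\<forall>t. (\<Sum>r\<in>(case t of (m, n) \<Rightarrow> {m - 1..m + 1} \<times> {n - 1..n + 1}).
        pmf \<pi> r * pmf (walk_kernel Q r) t) = pmf \<pi> t"
      using weight_balance by (auto simp: \<pi> w_def simp flip: sum_distrib_left sum_divide_distrib)
  qed (use pmf_walk_kernel_nonzeroD[OF nn] in auto)
  show ?thesis
  proof (intro exI conjI allI impI)
    show "stationary_distribution (walk_kernel Q) \<pi>' \<longleftrightarrow> \<pi>' = \<pi>" for \<pi>'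
      using stationary stationary_distribution_unique[OF assms(2)] by blast
    show "((\<lambda>(m, n). x_form Q c m n) has_sum 1) UNIV \<longleftrightarrow> c = c0" for c
    proof -
      have "(\<lambda>(m, n). x_form Q c m n) = (\<lambda>r. c / A * w r)"
        using x_form_eq_weight[of "c / A", folded A_def w_def] A by (auto simp: fun_eq_iff)
      moreover have "((\<lambda>r. c / A * w r) has_sum (c / A * S)) UNIV"
        by (rule has_sum_cmult_right[OF S])
      ultimately have "((\<lambda>(m, n). x_form Q c m n) has_sum 1) UNIV \<longleftrightarrow> c / A * S = 1"
        by (metis has_sum_unique)
      then show ?thesis using A \<open>S > 0\<close> by (auto simp: c0_def field_simps)
    qed
  qed (unfold \<pi>, rule closed(1), assumption+, rule closed(2), rule closed(3))
qed

end
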